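(* Let $k\geq 1$ and $n\geq k+1$ be integers and let $G$ be a $k$-tree on $n$ vertices. Then $q_1(G)\leq q_1(S_{k,n-k})$, with equality if and only if $G\cong S_{k,n-k}$.
   Context: A $k$-tree is either the complete graph $K_k$ or a graph obtained from a smaller $k$-tree by adding a new vertex joined by $k$ edges to the vertices of a $k$-clique. For a graph $G$, $q_1(G)$ denotes the largest eigenvalue of the signless Laplacian $Q(G)=D(G)+A(G)$ (degree diagonal matrix plus adjacency matrix). The $k$-star $S_{k,n-k}$ is the graph with vertex set $\{v_1,\dots,v_k,u_1,\dots,u_{n-k}\}$ in which $v_1,\dots,v_k$ form a clique, each $u_i$ is adjacent to all of $v_1,\dots,v_k$, and the $u_i$ are pairwise nonadjacent. *)

theory Defs
  imports "Graph_Theory.Graph_Theory" "Jordan_Normal_Form.Spectral_Radius"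
begin

text \<open>
  A finite simple graph is a \<^const>\<open>pair_graph\<close>: a finite, loop-free, symmetric set of
  arcs, each undirected edge being represented by its two orientations. The out-degree of
  a vertex is then its degree, and isomorphism is \<^const>\<open>digraph_iso\<close>.
\<close>

text \<open>
  Every copy of \<open>K\<^sub>k\<close> on vertices of type \<^typ>\<open>'a\<close> is admitted as a starting graph, so
  the predicate is closed under isomorphism. A k-clique is a set of k vertices
  inducing \<open>K\<^sub>k\<close>; the condition \<open>C \<subseteq> pverts G\<close> is needed because
  \<^const>\<open>induce_subgraph\<close> does not intersect with the vertex set.
\<close>

inductive k_tree :: "nat \<Rightarrow> 'a pair_pre_digraph \<Rightarrow> bool" for k :: nat where
  complete: "complete_digraph k (with_proj G) \<Longrightarrow> k_tree k G"
| add_vertex: "k_tree k G \<Longrightarrow> v \<notin> pverts G \<Longrightarrow> C \<subseteq> pverts G \<Longrightarrow>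
    complete_digraph k (induce_subgraph (with_proj G) C) \<Longrightarrow>
    k_tree k \<lparr>pverts = insert v (pverts G), parcs = parcs G \<union> {v} \<times> C \<union> C \<times> {v}\<rparr>"

lemma k_tree_pair_graph: "k_tree k G \<Longrightarrow> pair_graph G"
proof (induction rule: k_tree.induct)
  case (complete G)
  then show ?case by (rule pair_graphI_complete)
next
  case (add_vertex G v C)
  interpret pair_graph G by fact
  have "finite C" using add_vertex.hyps(3) pair_finite_verts by (rule finite_subset)
  moreover have "sym (parcs G)" using pair_sym_arcs by (simp add: symmetric_def)
  ultimately show ?case
    using add_vertex.hyps pair_finite_verts pair_finite_arcs
      arc_fst_in_verts arc_snd_in_verts pair_no_loops
    by unfold_locales (fastforce simp: symmetric_def intro!: symI dest: symD)+
qed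

text \<open>The vertices \<open>v\<^sub>i\<close> and \<open>u\<^sub>j\<close> of the k-star are \<^term>\<open>Inl i\<close> and \<^term>\<open>Inr j\<close>.\<close>

definition k_star :: "nat \<Rightarrow> nat \<Rightarrow> (nat + nat) pair_pre_digraph" where
  "k_star k m = (let V = Inl ` {1..k}; U = Inr ` {1..m} in
     \<lparr>pverts = V \<union> U, parcs = {(x, y). x \<in> V \<and> y \<in> V \<and> x \<noteq> y} \<union> V \<times> U \<union> U \<times> V\<rparr>)"

lemma pair_graph_k_star: "pair_graph (k_star k m)"
proof -
  have "finite (parcs (k_star k m))"
    by (rule finite_subset[of _ "pverts (k_star k m) \<times> pverts (k_star k m)"])
      (auto simp: k_star_def Let_def)
  then show ?thesis
    by unfold_locales (auto simp: k_star_def Let_def symmetric_def intro!: symI)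
qed

lemma k_tree_k_star: "k_tree k (k_star k m)"
proof (induction m)
  case 0
  show ?case
    by (rule k_tree.complete) (auto simp: complete_digraph_pair_def k_star_def Let_def card_image)
next
  case (Suc m)
  let ?V = "Inl ` {1..k} :: (nat + nat) set" and ?G = "k_star k m"
  have V: "arcs_ends (induce_subgraph (with_proj ?G) ?V) = {(u, v). (u, v) \<in> ?V \<times> ?V \<and> u \<noteq> v}"
    by (auto simp: arcs_ends_def arc_to_ends_def k_star_def Let_def image_iff)
  interpret pair_graph ?G by (rule pair_graph_k_star)
  have sub: "?V \<subseteq> pverts ?G" by (auto simp: k_star_def Let_def)
  have "symmetric (induce_subgraph (with_proj ?G) ?V)"
    unfolding symmetric_def V by (auto intro!: symI)
  then have "graph (induce_subgraph (with_proj ?G) ?V)"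
    using no_multi_arcs no_loops by unfold_locales auto
  then have "complete_digraph k (induce_subgraph (with_proj ?G) ?V)"
    unfolding complete_digraph_def V by (auto simp: card_image)
  moreover have "Inr (Suc m) \<notin> pverts ?G"
    by (auto simp: k_star_def Let_def)
  ultimately have "k_tree k \<lparr>pverts = insert (Inr (Suc m)) (pverts ?G),
      parcs = parcs ?G \<union> {Inr (Suc m)} \<times> ?V \<union> ?V \<times> {Inr (Suc m)}\<rparr>"
    by (intro k_tree.add_vertex[OF Suc _ sub])
  also have "\<dots> = k_star k (Suc m)"
    by (auto simp: k_star_def Let_def atLeastAtMostSuc_conv)
  finally show ?case .
qed

text \<open>
  The matrices of a graph are indexed by \<open>{0..<n}\<close>, so an enumeration of the vertices has to
  be chosen. The lemma \<open>eigenvalue_signless_laplacian_iff\<close> below shows that the eigenvalues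
  do not depend on this choice.
\<close>

definition vertex_list :: "('a, 'b) pre_digraph \<Rightarrow> 'a list" where
  "vertex_list G = (SOME vs. set vs = verts G \<and> distinct vs)"

definition adjacency_matrix :: "('a, 'b) pre_digraph \<Rightarrow> real mat" where
  "adjacency_matrix G = (let vs = vertex_list G; n = length vs in
     mat n n (\<lambda>(i, j). if (vs ! i, vs ! j) \<in> arcs_ends G then 1 else 0))"

definition degree_matrix :: "('a, 'b) pre_digraph \<Rightarrow> real mat" where
  "degree_matrix G = (let vs = vertex_list G in
     mat_diag (length vs) (\<lambda>i. real (out_degree G (vs ! i))))"

definition signless_laplacian :: "('a, 'b) pre_digraph \<Rightarrow> real mat" where
  "signless_laplacian G = degree_matrix G + adjacency_matrix G"

text \<open>
  The matrix is real symmetric, so all of its eigenvalues are real and \<^const>\<open>spectrum\<close>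
  over the reals contains every one of them.
\<close>

definition q1 :: "('a, 'b) pre_digraph \<Rightarrow> real" where
  "q1 G = Max (spectrum (signless_laplacian G))"

lemma vertex_list:
  assumes "finite (verts G)"
  shows "set (vertex_list G) = verts G" "distinct (vertex_list G)"
  using someI_ex[OF finite_distinct_list[OF assms]] unfolding vertex_list_def by blast+

lemma signless_laplacian_carrier:
  "signless_laplacian G \<in> carrier_mat (length (vertex_list G)) (length (vertex_list G))"
  by (simp add: signless_laplacian_def degree_matrix_def adjacency_matrix_def Let_def mat_diag_def)

lemma signless_laplacian_mult_vec:
  fixes x :: "'a \<Rightarrow> real"
  assumes fin: "finite (pverts G)" and i: "i < length (vertex_list (with_proj G))"
  defines "vs \<equiv> vertex_list (with_proj G)"
  assumes wf: "pair_wf_digraph G"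
  shows "(signless_laplacian (with_proj G) *\<^sub>v vec (length vs) (\<lambda>j. x (vs ! j))) $ i =
    real (out_degree (with_proj G) (vs ! i)) * x (vs ! i) + (\<Sum>w | (vs ! i, w) \<in> parcs G. x w)"
proof -
  let ?n = "length vs"
  have vs: "set vs = pverts G" "distinct vs"
    using vertex_list[of "with_proj G"] fin by (simp_all add: vs_def)
  have i': "i < ?n" using i by (simp add: vs_def)
  have arcs: "arcs_ends (with_proj G) = parcs G"
    by (auto simp: arcs_ends_def arc_to_ends_def)
  have entry: "signless_laplacian (with_proj G) $$ (i, j) =
      (if i = j then real (out_degree (with_proj G) (vs ! i)) else 0) +
      (if (vs ! i, vs ! j) \<in> parcs G then 1 else 0)" if "j < ?n" for j
    using that i' by (simp add: signless_laplacian_def degree_matrix_def adjacency_matrix_def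
        Let_def mat_diag_def vs_def[symmetric] arcs)
  have dims: "dim_row (signless_laplacian (with_proj G)) = ?n" "dim_col (signless_laplacian (with_proj G)) = ?n"
    using signless_laplacian_carrier[of "with_proj G"] by (auto simp: vs_def)
  have "(signless_laplacian (with_proj G) *\<^sub>v vec ?n (\<lambda>j. x (vs ! j))) $ i =
      (\<Sum>j = 0..<?n. signless_laplacian (with_proj G) $$ (i, j) * x (vs ! j))"
    using i' dims by (simp add: scalar_prod_def)
  also have "\<dots> = (\<Sum>j = 0..<?n. (if i = j then real (out_degree (with_proj G) (vs ! i)) * x (vs ! i) else 0) +
      (if (vs ! i, vs ! j) \<in> parcs G then x (vs ! j) else 0))"
    by (rule sum.cong) (auto simp: entry algebra_simps)
  also have "\<dots> = real (out_degree (with_proj G) (vs ! i)) * x (vs ! i) +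
      (\<Sum>j = 0..<?n. if (vs ! i, vs ! j) \<in> parcs G then x (vs ! j) else 0)"
    using i' by (simp add: sum.distrib)
  also have "(\<Sum>j = 0..<?n. if (vs ! i, vs ! j) \<in> parcs G then x (vs ! j) else 0) =
      (\<Sum>w\<in>set vs. if (vs ! i, w) \<in> parcs G then x w else 0)"
    using vs(2) by (intro sum.reindex_bij_betw)
      (auto simp: bij_betw_def inj_on_nth set_conv_nth image_def)
  also have "\<dots> = (\<Sum>w | (vs ! i, w) \<in> parcs G. x w)"
    using pair_wf_digraph.arc_snd_in_verts[OF wf] vs(1) fin
    by (intro sum.mono_neutral_cong_right) auto
  finally show ?thesis .
qed

lemma eigenvalue_signless_laplacian_iff:
  assumes "pair_fin_digraph G"
  shows "eigenvalue (signless_laplacian (with_proj G)) \<mu> \<longleftrightarrow>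
    (\<exists>x. (\<exists>v\<in>pverts G. x v \<noteq> 0) \<and>
      (\<forall>v\<in>pverts G. real (out_degree (with_proj G) v) * x v + (\<Sum>w | (v, w) \<in> parcs G. x w) = \<mu> * x v))"
    (is "?L \<longleftrightarrow> ?R")
proof -
  interpret pair_fin_digraph G by fact
  define vs where "vs = vertex_list (with_proj G)"
  let ?n = "length vs" and ?Q = "signless_laplacian (with_proj G)"
  have vs: "set vs = pverts G" "distinct vs"
    using vertex_list[of "with_proj G"] by (simp_all add: vs_def)
  have dims: "dim_row ?Q = ?n" "dim_col ?Q = ?n"
    using signless_laplacian_carrier[of "with_proj G"] by (auto simp: vs_def)
  have mult: "(?Q *\<^sub>v vec ?n (\<lambda>j. x (vs ! j))) $ i =
      real (out_degree (with_proj G) (vs ! i)) * x (vs ! i) + (\<Sum>w | (vs ! i, w) \<in> parcs G. x w)"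
    if "i < ?n" for x i
    using signless_laplacian_mult_vec[of G i x] that pair_finite_verts pair_wf_digraph_axioms
    by (simp add: vs_def)
  have bex_nth: "(\<exists>v\<in>set vs. P v) \<longleftrightarrow> (\<exists>i<?n. P (vs ! i))" for P
    by (metis in_set_conv_nth)
  have vec_x: "eigenvector ?Q (vec ?n (\<lambda>j. x (vs ! j))) \<mu> \<longleftrightarrow>
      (\<exists>v\<in>pverts G. x v \<noteq> 0) \<and>
      (\<forall>v\<in>pverts G. real (out_degree (with_proj G) v) * x v + (\<Sum>w | (v, w) \<in> parcs G. x w) = \<mu> * x v)" for x
    unfolding eigenvector_def vs(1)[symmetric]
    by (auto simp: dims vec_eq_iff all_set_conv_all_nth bex_nth mult
        simp del: index_mult_mat_vec)
  show ?thesis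
  proof
    assume ?L
    then obtain y where y: "eigenvector ?Q y \<mu>" by (auto simp: eigenvalue_def)
    then have dy: "dim_vec y = ?n" by (auto simp: eigenvector_def dims)
    define x where "x v = y $ (THE j. j < ?n \<and> vs ! j = v)" for v
    have "x (vs ! j) = y $ j" if "j < ?n" for j
    proof -
      have "(THE j'. j' < ?n \<and> vs ! j' = vs ! j) = j"
        using that vs(2) by (intro the_equality) (auto simp: nth_eq_iff_index_eq)
      then show ?thesis by (simp add: x_def)
    qed
    then have "vec ?n (\<lambda>j. x (vs ! j)) = y" using dy by (intro eq_vecI) auto
    with y vec_x show ?R by metis
  next
    assume ?R
    with vec_x show ?L unfolding eigenvalue_def by metis
  qed
qed

end

theory Submission
  imports Defs
begin

text \<open>
  Let \<open>y\<close> be the entrywise absolute value of an eigenvector for \<open>q\<^sub>1(G)\<close>. Building up \<open>G\<close> vertex by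
  vertex shows that, for every weight monotone in both end values \<open>y u\<close>, \<open>y w\<close>, the total weight of
  \<open>G\<close> is at most that of the k-star on the same vertices whose centres carry the \<open>k\<close> largest values of
  \<open>y\<close>. With the weight \<open>(y u + y w)\<^sup>2\<close> this compares the quadratic forms, and the positive eigenvector
  \<open>z\<close> of the star bounds its form by \<open>q\<^sub>1\<close> of the star, the defect being
  \<open>\<Sum> z u * z w * (y u / z u - y w / z w)\<^sup>2\<close>. In the case of equality \<open>y\<close> is therefore a multiple of
  \<open>z\<close>, hence takes just two values; the constant weight shows that \<open>G\<close> has no more edges than the
  star, so equality of the forms forces \<open>G\<close> to be that star.
\<close>

section \<open>Arc sums and quadratic forms of eigenfunctions\<close>

lemma sum_arcs_eq:
  fixes g :: "'a \<Rightarrow> 'a \<Rightarrow> real"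
  assumes "finite V" "E \<subseteq> V \<times> V"
  shows "(\<Sum>(u, w)\<in>E. g u w) = (\<Sum>u\<in>V. \<Sum>w | (u, w) \<in> E. g u w)"
proof -
  have E: "Sigma V (\<lambda>u. {w. (u, w) \<in> E}) = E" using assms(2) by auto
  have "\<forall>u\<in>V. finite {w. (u, w) \<in> E}"
    using assms by (auto intro: finite_subset[of _ V])
  from sum.Sigma[OF assms(1) this, of g] show ?thesis by (simp only: E)
qed

lemma sum_sym_arcs_swap:
  assumes "sym E"
  shows "(\<Sum>(u, w)\<in>E. g w u) = (\<Sum>(u, w)\<in>E. g u w)"
  by (rule sum.reindex_bij_witness[of _ prod.swap prod.swap])
    (use assms in \<open>auto dest: symD\<close>)

definition signless_eigenfunction ::
    "'a set \<Rightarrow> ('a \<times> 'a) set \<Rightarrow> real \<Rightarrow> ('a \<Rightarrow> real) \<Rightarrow> bool" where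
  "signless_eigenfunction V E \<mu> x \<longleftrightarrow> (\<forall>v\<in>V. (\<Sum>w | (v, w) \<in> E. x v + x w) = \<mu> * x v)"

text \<open>Each square splits into \<open>x u * (x u + x w)\<close> and the same term with the ends
  exchanged. Symmetry of \<open>E\<close> makes the two sums equal, and the equation at
  \<open>u\<close> evaluates each. The factor 2 reflects that every edge is counted in both
  orientations.\<close>

lemma quadratic_form_eigenfunction:
  assumes V: "finite V" "E \<subseteq> V \<times> V" "sym E" and x: "signless_eigenfunction V E \<mu> x"
  shows "(\<Sum>(u, w)\<in>E. (x u + x w)\<^sup>2) = 2 * \<mu> * (\<Sum>v\<in>V. (x v)\<^sup>2)"
proof -
  have "(\<Sum>w | (u, w) \<in> E. x u * (x u + x w)) = \<mu> * (x u)\<^sup>2" if "u \<in> V" for u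
  proof -
    have "(\<Sum>w | (u, w) \<in> E. x u * (x u + x w)) = x u * (\<mu> * x u)"
      using x that unfolding signless_eigenfunction_def sum_distrib_left[symmetric] by metis
    then show ?thesis by (simp add: power2_eq_square)
  qed
  then have half: "(\<Sum>(u, w)\<in>E. x u * (x u + x w)) = \<mu> * (\<Sum>v\<in>V. (x v)\<^sup>2)"
    unfolding sum_arcs_eq[OF V(1,2)] by (simp add: sum_distrib_left)
  have "(\<Sum>(u, w)\<in>E. (x u + x w)\<^sup>2) =
      (\<Sum>(u, w)\<in>E. x u * (x u + x w)) + (\<Sum>(u, w)\<in>E. x w * (x w + x u))"
    unfolding sum.distrib[symmetric]
    by (intro sum.cong refl) (auto simp: power2_eq_square algebra_simps)
  with half show ?thesis
    using sum_sym_arcs_swap[OF V(3), of "\<lambda>u w. x u * (x u + x w)"] by simp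
qed

text \<open>A ground-state identity for arbitrary \<open>x\<close>. On each arc the cross terms of
  the square and of the defect cancel, leaving \<open>(x u)\<^sup>2 / z u * (z u + z w)\<close> and
  its mirror image; the equation for \<open>z\<close> then evaluates the sum of each.\<close>

lemma quadratic_form_positive_eigenfunction:
  assumes V: "finite V" "E \<subseteq> V \<times> V" "sym E" and z: "signless_eigenfunction V E q z"
    and pos: "\<forall>v\<in>V. z v > 0"
  shows "(\<Sum>(u, w)\<in>E. (x u + x w)\<^sup>2) + (\<Sum>(u, w)\<in>E. z u * z w * (x u / z u - x w / z w)\<^sup>2)
    = 2 * q * (\<Sum>v\<in>V. (x v)\<^sup>2)"
proof -
  have "(\<Sum>w | (u, w) \<in> E. (x u)\<^sup>2 / z u * (z u + z w)) = q * (x u)\<^sup>2" if "u \<in> V" for u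
  proof -
    have "(\<Sum>w | (u, w) \<in> E. (x u)\<^sup>2 / z u * (z u + z w)) = (x u)\<^sup>2 / z u * (q * z u)"
      using z that unfolding signless_eigenfunction_def sum_distrib_left[symmetric] by metis
    also have "\<dots> = q * (x u)\<^sup>2" using pos that by (simp add: less_le)
    finally show ?thesis .
  qed
  then have half: "(\<Sum>(u, w)\<in>E. (x u)\<^sup>2 / z u * (z u + z w)) = q * (\<Sum>v\<in>V. (x v)\<^sup>2)"
    unfolding sum_arcs_eq[OF V(1,2)] by (simp add: sum_distrib_left)
  have "(x u + x w)\<^sup>2 + z u * z w * (x u / z u - x w / z w)\<^sup>2 =
      (x u)\<^sup>2 / z u * (z u + z w) + (x w)\<^sup>2 / z w * (z w + z u)" if "(u, w) \<in> E" for u w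
  proof -
    have "z u > 0" "z w > 0" using that V(2) pos by auto
    then show ?thesis by (simp add: power2_eq_square field_simps)
  qed
  then have "(\<Sum>(u, w)\<in>E. (x u + x w)\<^sup>2) + (\<Sum>(u, w)\<in>E. z u * z w * (x u / z u - x w / z w)\<^sup>2) =
      (\<Sum>(u, w)\<in>E. (x u)\<^sup>2 / z u * (z u + z w)) + (\<Sum>(u, w)\<in>E. (x w)\<^sup>2 / z w * (z w + z u))"
    unfolding sum.distrib[symmetric] by (intro sum.cong) auto
  with half show ?thesis
    using sum_sym_arcs_swap[OF V(3), of "\<lambda>u w. (x u)\<^sup>2 / z u * (z u + z w)"] by simp
qed

lemma quadratic_form_le_positive_eigenfunction:
  assumes "finite V" "E \<subseteq> V \<times> V" "sym E" "signless_eigenfunction V E q z"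
    and pos: "\<forall>v\<in>V. z v > 0"
  shows "(\<Sum>(u, w)\<in>E. (x u + x w)\<^sup>2) \<le> 2 * q * (\<Sum>v\<in>V. (x v)\<^sup>2)"
proof -
  have "z u * z w * (x u / z u - x w / z w)\<^sup>2 \<ge> 0" if "(u, w) \<in> E" for u w
  proof -
    have "z u > 0" "z w > 0" using that assms(2) pos by auto
    then show ?thesis by simp
  qed
  then have "(\<Sum>(u, w)\<in>E. z u * z w * (x u / z u - x w / z w)\<^sup>2) \<ge> 0"
    by (intro sum_nonneg) auto
  with quadratic_form_positive_eigenfunction[OF assms, of x] show ?thesis by linarith
qed

lemma quadratic_form_eq_positive_eigenfunction:
  assumes "finite V" "E \<subseteq> V \<times> V" "sym E" "signless_eigenfunction V E q z"
    and pos: "\<forall>v\<in>V. z v > 0"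
    and eq: "(\<Sum>(u, w)\<in>E. (x u + x w)\<^sup>2) = 2 * q * (\<Sum>v\<in>V. (x v)\<^sup>2)"
    and "(u, w) \<in> E"
  shows "x u / z u = x w / z w"
proof -
  have posE: "z u > 0" "z w > 0" if "(u, w) \<in> E" for u w
    using that assms(2) pos by auto
  have fin: "finite E" using assms(1,2) finite_subset by blast
  have "(\<Sum>(u, w)\<in>E. z u * z w * (x u / z u - x w / z w)\<^sup>2) = 0"
    using quadratic_form_positive_eigenfunction[OF assms(1-5), of x] eq by simp
  moreover have "\<forall>p\<in>E. 0 \<le> (case p of (u, w) \<Rightarrow> z u * z w * (x u / z u - x w / z w)\<^sup>2)"
  proof clarify
    fix a b assume "(a, b) \<in> E"
    from posE[OF this] show "0 \<le> z a * z b * (x a / z a - x b / z b)\<^sup>2" by simp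
  qed
  ultimately have "\<forall>p\<in>E. (case p of (u, w) \<Rightarrow> z u * z w * (x u / z u - x w / z w)\<^sup>2) = 0"
    using sum_nonneg_eq_0_iff[OF fin] by blast
  with \<open>(u, w) \<in> E\<close> have "z u * z w * (x u / z u - x w / z w)\<^sup>2 = 0" by auto
  with posE[OF \<open>(u, w) \<in> E\<close>] show ?thesis by simp
qed

section \<open>Existence of the largest eigenvalue and its detection by a positive
  eigenfunction\<close>

lemma eigenvalue_signless_laplacian_iff_eigenfunction:
  assumes "pair_fin_digraph G"
  shows "eigenvalue (signless_laplacian (with_proj G)) \<mu> \<longleftrightarrow>
    (\<exists>x. (\<exists>v\<in>pverts G. x v \<noteq> 0) \<and> signless_eigenfunction (pverts G) (parcs G) \<mu> x)"
proof -
  interpret pair_fin_digraph G by fact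
  have "real (out_degree (with_proj G) v) = (\<Sum>w | (v, w) \<in> parcs G. 1)" for v
  proof -
    have "out_arcs (with_proj G) v = Pair v ` {w. (v, w) \<in> parcs G}"
      by (auto simp: out_arcs_def)
    then show ?thesis by (simp add: out_degree_def card_image inj_on_def)
  qed
  then show ?thesis
    by (simp add: eigenvalue_signless_laplacian_iff[OF assms] signless_eigenfunction_def
        sum.distrib)
qed

text \<open>The Hermitian form \<open>S\<close> of an eigenvector equals \<open>\<mu> * N\<close>;
  since \<open>A\<close> is real and symmetric, \<open>S\<close> is its own conjugate, and
  \<open>N > 0\<close> can be cancelled.\<close>

lemma complex_eigenvalue_symmetric_real:
  fixes A :: "real mat"
  assumes A: "A \<in> carrier_mat n n" and sym: "\<And>i j. i < n \<Longrightarrow> j < n \<Longrightarrow> A $$ (i, j) = A $$ (j, i)"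
    and ev: "eigenvalue (map_mat complex_of_real A) \<mu>"
  shows "\<mu> \<in> \<real>"
proof -
  obtain v where v: "v \<in> carrier_vec n" "v \<noteq> 0\<^sub>v n"
      and eq: "map_mat complex_of_real A *\<^sub>v v = \<mu> \<cdot>\<^sub>v v"
    using ev A by (auto simp: eigenvalue_def eigenvector_def)
  have row: "(\<Sum>j<n. of_real (A $$ (i, j)) * v $ j) = \<mu> * v $ i" if "i < n" for i
  proof -
    have "(map_mat complex_of_real A *\<^sub>v v) $ i = (\<Sum>j<n. of_real (A $$ (i, j)) * v $ j)"
      using that A v by (simp add: scalar_prod_def atLeast0LessThan)
    with eq that v show ?thesis by simp
  qed
  define S where "S = (\<Sum>i<n. \<Sum>j<n. cnj (v $ i) * (of_real (A $$ (i, j)) * v $ j))"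
  define N where "N = (\<Sum>i<n. (cmod (v $ i))\<^sup>2)"
  have "S = (\<Sum>i<n. cnj (v $ i) * (\<mu> * v $ i))"
    unfolding S_def by (intro sum.cong refl) (simp add: sum_distrib_left[symmetric] row)
  also have "\<dots> = \<mu> * of_real N"
    by (simp add: N_def sum_distrib_left complex_norm_square mult_ac flip: of_real_power)
  finally have S: "S = \<mu> * of_real N" .
  have "cnj S = (\<Sum>i<n. \<Sum>j<n. cnj (v $ j) * (of_real (A $$ (i, j)) * v $ i))"
    by (simp add: S_def cnj_sum mult_ac)
  also have "\<dots> = (\<Sum>j<n. \<Sum>i<n. cnj (v $ j) * (of_real (A $$ (i, j)) * v $ i))"
    by (rule sum.swap)
  also have "\<dots> = S"
    unfolding S_def by (intro sum.cong refl) (simp add: sym)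
  finally have "cnj \<mu> * of_real N = \<mu> * of_real N" using S by simp
  moreover have "N > 0"
  proof -
    obtain i where "i < n" "v $ i \<noteq> 0"
      using v by (metis carrier_vecD eq_vecI index_zero_vec)
    then show ?thesis unfolding N_def by (intro sum_pos2[of _ i]) auto
  qed
  ultimately show ?thesis by (simp add: Reals_cnj_iff)
qed

text \<open>Ensures that the \<open>Max\<close> in \<open>q1\<close> is taken over a nonempty set: a
  complex eigenvalue exists, symmetry makes it real, and it is then a root of the real
  characteristic polynomial.\<close>

lemma spectrum_symmetric_real_nonempty:
  fixes A :: "real mat"
  assumes A: "A \<in> carrier_mat n n" and "n > 0"
    and sym: "\<And>i j. i < n \<Longrightarrow> j < n \<Longrightarrow> A $$ (i, j) = A $$ (j, i)"
  shows "spectrum A \<noteq> {}"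
proof -
  have A': "map_mat complex_of_real A \<in> carrier_mat n n" using A by simp
  obtain \<mu> where \<mu>: "eigenvalue (map_mat complex_of_real A) \<mu>"
    using spectrum_non_empty[OF A' \<open>n > 0\<close>] by (auto simp: spectrum_def)
  then obtain r where "\<mu> = of_real r"
    using complex_eigenvalue_symmetric_real[OF A sym] by (auto elim: Reals_cases)
  with \<mu> have "poly (map_poly of_real (char_poly A)) (complex_of_real r) = 0"
    by (simp add: eigenvalue_root_char_poly[OF A'] of_real_hom.char_poly_hom[OF A])
  then have "poly (char_poly A) r = 0" by simp
  then show ?thesis by (auto simp: spectrum_def eigenvalue_root_char_poly[OF A])
qed

lemma finite_spectrum_signless_laplacian: "finite (spectrum (signless_laplacian G))"
  using signless_laplacian_carrier by (rule card_finite_spectrum)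

lemma eigenvalue_q1:
  assumes "pair_graph G" "pverts G \<noteq> {}"
  shows "eigenvalue (signless_laplacian (with_proj G)) (q1 (with_proj G))"
proof -
  interpret pair_graph G by fact
  let ?vs = "vertex_list (with_proj G)"
  have "set ?vs = pverts G" using vertex_list(1)[of "with_proj G"] by simp
  with assms(2) have len: "length ?vs > 0" by auto
  have sym: "(u, v) \<in> parcs G \<longleftrightarrow> (v, u) \<in> parcs G" for u v
    using pair_sym_arcs by (auto simp: symmetric_def dest: symD)
  have "spectrum (signless_laplacian (with_proj G)) \<noteq> {}"
    by (rule spectrum_symmetric_real_nonempty[OF signless_laplacian_carrier len])
      (auto simp: signless_laplacian_def degree_matrix_def adjacency_matrix_def Let_def
        mat_diag_def dest: sym[THEN iffD1])
  then have "q1 (with_proj G) \<in> spectrum (signless_laplacian (with_proj G))"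
    unfolding q1_def by (intro Max_in finite_spectrum_signless_laplacian)
  then show ?thesis by (simp add: spectrum_def)
qed

text \<open>Takes the place of Perron-Frobenius: for an eigenfunction \<open>x\<close> of any
  eigenvalue \<open>\<mu>\<close>, the form is exactly \<open>2 * \<mu>\<close> times the squared
  norm of \<open>x\<close>, while \<open>z\<close> bounds it by \<open>2 * q\<close> times that
  norm.\<close>

lemma q1_eq_positive_eigenfunction:
  assumes "pair_graph G" "pverts G \<noteq> {}"
    and z: "signless_eigenfunction (pverts G) (parcs G) q z"
    and pos: "\<forall>v\<in>pverts G. z v > 0"
  shows "q1 (with_proj G) = q"
  unfolding q1_def
proof (rule Max_eqI[OF finite_spectrum_signless_laplacian])
  interpret pair_graph G by fact
  have E: "parcs G \<subseteq> pverts G \<times> pverts G" "sym (parcs G)"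
    using in_arcsD1 in_arcsD2 pair_sym_arcs by (auto simp: symmetric_def)
  note iff = eigenvalue_signless_laplacian_iff_eigenfunction[OF pair_fin_digraph_axioms]
  have "\<exists>v\<in>pverts G. z v \<noteq> 0" using assms(2) pos by (metis all_not_in_conv less_irrefl)
  with z show "q \<in> spectrum (signless_laplacian (with_proj G))"
    unfolding spectrum_def by (auto simp: iff)
  fix \<mu> assume "\<mu> \<in> spectrum (signless_laplacian (with_proj G))"
  then obtain x v where x: "v \<in> pverts G" "x v \<noteq> 0"
      "signless_eigenfunction (pverts G) (parcs G) \<mu> x"
    by (auto simp: spectrum_def iff)
  have "2 * \<mu> * (\<Sum>v\<in>pverts G. (x v)\<^sup>2) \<le> 2 * q * (\<Sum>v\<in>pverts G. (x v)\<^sup>2)"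
    using quadratic_form_eigenfunction[OF pair_finite_verts E x(3)]
      quadratic_form_le_positive_eigenfunction[OF pair_finite_verts E z pos, of x] by simp
  moreover have "(\<Sum>v\<in>pverts G. (x v)\<^sup>2) > 0"
    using x by (intro sum_pos2[of _ v]) auto
  ultimately show "\<mu> \<le> q" by simp
qed

section \<open>The star on a given vertex set and its eigenfunction\<close>

text \<open>The k-star with centres \<open>T\<close>, placed on the vertices of \<open>G\<close>
  itself, so that both graphs can be weighted by the same vertex function.\<close>

definition star_arcs :: "'a set \<Rightarrow> 'a set \<Rightarrow> ('a \<times> 'a) set" where
  "star_arcs T V = {(u, w). u \<in> V \<and> w \<in> V \<and> u \<noteq> w \<and> (u \<in> T \<or> w \<in> T)}"

lemma star_arcs_subset: "star_arcs T V \<subseteq> V \<times> V"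
  and sym_star_arcs: "sym (star_arcs T V)"
  by (auto simp: star_arcs_def intro: symI)

lemma finite_star_arcs: "finite V \<Longrightarrow> finite (star_arcs T V)"
  using star_arcs_subset by (rule finite_subset) simp

text \<open>An eigenfunction constant on centres and on leaves. With leaf value \<open>k\<close>,
  the equation at a leaf reads \<open>k * (k + a) = q * k\<close> and forces
  \<open>q = a + k\<close>; the equation at a centre then becomes the quadratic assumed for
  \<open>a\<close>.\<close>

lemma star_eigenfunction:
  fixes k :: nat and a :: real
  assumes V: "finite V" "T \<subseteq> V" "card T = k" and k: "k \<ge> 1" "card V \<ge> k + 1"
    and a: "a * (a - (real (card V) - 2)) = real k * (real (card V) - real k)"
  shows "signless_eigenfunction V (star_arcs T V) (a + k) (\<lambda>v. if v \<in> T then a else k)"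
  unfolding signless_eigenfunction_def
proof
  let ?z = "\<lambda>v. if v \<in> T then a else real k"
  have fT: "finite T" using V by (auto intro: finite_subset)
  have cVT: "card (V - T) = card V - k" using V fT by (simp add: card_Diff_subset)
  fix v assume v: "v \<in> V"
  show "(\<Sum>w | (v, w) \<in> star_arcs T V. ?z v + ?z w) = (a + k) * ?z v"
  proof (cases "v \<in> T")
    case True
    then have "{w. (v, w) \<in> star_arcs T V} = (T - {v}) \<union> (V - T)"
      using V v by (auto simp: star_arcs_def)
    moreover have "(T - {v}) \<inter> (V - T) = {}" by auto
    ultimately have "(\<Sum>w | (v, w) \<in> star_arcs T V. ?z v + ?z w) =
        (\<Sum>w\<in>T - {v}. ?z v + ?z w) + (\<Sum>w\<in>V - T. ?z v + ?z w)"
      using V fT by (simp only: sum.union_disjoint finite_Diff)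
    also have "\<dots> = (\<Sum>w\<in>T - {v}. 2 * a) + (\<Sum>w\<in>V - T. a + k)"
      using True by (intro arg_cong2[of _ _ _ _ "(+)"] sum.cong) auto
    also have "\<dots> = (real k - 1) * (2 * a) + (real (card V) - k) * (a + k)"
      using True V fT k cVT by (simp add: of_nat_diff)
    also have "\<dots> = (a + k) * a" using a by (simp add: algebra_simps)
    finally show ?thesis using True by simp
  next
    case False
    then have "{w. (v, w) \<in> star_arcs T V} = T"
      using V v by (auto simp: star_arcs_def)
    then show ?thesis using False V by (simp add: algebra_simps)
  qed
qed

text \<open>\<open>a\<close> is the larger root of the quadratic. If \<open>n > k + 1\<close>, then
  \<open>k \<le> n - 2\<close>, so \<open>a \<le> k\<close> would make the left side nonpositive.
  The bound \<open>a > k\<close> separates centres from leaves in the equality case.\<close>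

lemma star_positive_root:
  fixes k n :: nat
  assumes "k \<ge> 1" "n \<ge> k + 1"
  obtains a :: real where "a > 0" "a * (a - (real n - 2)) = real k * (real n - real k)"
    "n > k + 1 \<Longrightarrow> a > k"
proof -
  define p s where "p = real n - 2" and "s = sqrt (p\<^sup>2 + 4 * (real k * (real n - real k)))"
  define a where "a = (p + s) / 2"
  have pos: "real k * (real n - real k) > 0" using assms by simp
  have "s\<^sup>2 = p\<^sup>2 + 4 * (real k * (real n - real k))"
    unfolding s_def using pos by (intro real_sqrt_pow2) (smt (verit) zero_le_power2)
  then have a: "a * (a - p) = real k * (real n - real k)"
    by (simp add: a_def field_simps power2_eq_square)
  have "s > \<bar>p\<bar>" unfolding s_def using pos by (intro real_less_rsqrt) simp
  then have "a > 0" by (simp add: a_def)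
  have "a > k" if "n > k + 1"
  proof (rule ccontr)
    assume "\<not> a > k"
    with that have "a - p \<le> 0" by (simp add: p_def)
    with \<open>a > 0\<close> have "a * (a - p) \<le> 0" by (simp add: mult_nonneg_nonpos)
    with a pos show False by simp
  qed
  with \<open>a > 0\<close> a that show thesis by (simp add: p_def)
qed

section \<open>Comparison of a k-tree with a star\<close>

text \<open>The common part cancels, and \<open>C - T\<close> and \<open>T - C\<close> are
  equinumerous; a bijection between them pairs each element outside \<open>T\<close> with one of
  \<open>T\<close> that dominates it.\<close>

lemma sum_le_sum_top:
  fixes g :: "'a \<Rightarrow> real"
  assumes V: "finite V" "T \<subseteq> V" "C \<subseteq> V" "card C = card T"
    and top: "\<And>t u. t \<in> T \<Longrightarrow> u \<in> V - T \<Longrightarrow> g u \<le> g t"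
  shows "sum g C \<le> sum g T"
proof -
  have fin: "finite T" "finite C" using V by (auto intro: finite_subset)
  have "card (T - C) = card (C - T)"
    using fin V(4) card_Diff_subset_Int[of T C] card_Diff_subset_Int[of C T]
    by (simp add: Int_commute)
  then obtain h where h: "bij_betw h (T - C) (C - T)"
    using fin by (meson bij_betw_iff_card finite_Diff)
  have "sum g (C - T) = (\<Sum>t\<in>T - C. g (h t))"
    using h by (simp add: sum.reindex_bij_betw)
  also have "\<dots> \<le> sum g (T - C)"
    using bij_betwE[OF h] V(3) by (intro sum_mono top) auto
  finally show ?thesis
    using fin sum.Int_Diff[of C g T] sum.Int_Diff[of T g C] by (simp add: Int_commute)
qed

lemma sum_add_vertex:
  fixes g :: "'a \<Rightarrow> 'a \<Rightarrow> real"
  assumes "finite E" "finite C" "E \<subseteq> V \<times> V" "C \<subseteq> V" "v \<notin> V"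
  shows "(\<Sum>(u, w)\<in>E \<union> {v} \<times> C \<union> C \<times> {v}. g u w) =
    (\<Sum>(u, w)\<in>E. g u w) + (\<Sum>c\<in>C. g v c + g c v)"
proof -
  have "(\<Sum>(u, w)\<in>E \<union> {v} \<times> C \<union> C \<times> {v}. g u w) =
      (\<Sum>(u, w)\<in>E. g u w) + (\<Sum>(u, w)\<in>{v} \<times> C. g u w) + (\<Sum>(u, w)\<in>C \<times> {v}. g u w)"
    using assms by (subst sum.union_disjoint; (subst sum.union_disjoint)?) auto
  then show ?thesis
    by (simp add: sum.cartesian_product[symmetric] sum.distrib)
qed

text \<open>
  When the new vertex \<open>v\<close> beats some \<open>t \<in> T\<close>, it takes over the role of the least such \<open>t\<close>
  as a centre of the star.
\<close>

lemma k_tree_arc_sum_le_star: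
  fixes x :: "'a \<Rightarrow> real"
  assumes "k_tree k G" and x: "\<And>v. x v \<ge> 0"
  shows "\<exists>T\<subseteq>pverts G. card T = k \<and> (\<forall>t\<in>T. \<forall>u\<in>pverts G - T. x u \<le> x t) \<and>
    (\<forall>f :: real \<Rightarrow> real \<Rightarrow> real.
      (\<forall>a a' b b'. 0 \<le> a \<longrightarrow> a \<le> a' \<longrightarrow> 0 \<le> b \<longrightarrow> b \<le> b' \<longrightarrow> f a b \<le> f a' b') \<longrightarrow>
      (\<Sum>(u, w)\<in>parcs G. f (x u) (x w)) \<le> (\<Sum>(u, w)\<in>star_arcs T (pverts G). f (x u) (x w)))"
  using assms(1)
proof (induction rule: k_tree.induct)
  case (complete G)
  then have "card (pverts G) = k" "parcs G = star_arcs (pverts G) (pverts G)"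
    by (auto simp: complete_digraph_pair_def star_arcs_def)
  \<comment> \<open>The complete graph is a star without leaves, so the dominance condition on
    \<open>T\<close> is vacuous.\<close>
  then show ?case by (intro exI[of _ "pverts G"]) auto
next
  case (add_vertex G v C)
  let ?V = "pverts G"
  let ?mono = "\<lambda>f :: real \<Rightarrow> real \<Rightarrow> real.
    \<forall>a a' b b'. 0 \<le> a \<longrightarrow> a \<le> a' \<longrightarrow> 0 \<le> b \<longrightarrow> b \<le> b' \<longrightarrow> f a b \<le> f a' b'"
  interpret pair_graph G using add_vertex.hyps(1) by (rule k_tree_pair_graph)
  have V: "finite ?V" "finite (parcs G)" "parcs G \<subseteq> ?V \<times> ?V"
    using in_arcsD1 in_arcsD2 by auto
  have C: "C \<subseteq> ?V" "finite C" "card C = k"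
    using add_vertex.hyps(3,4) V by (auto simp: complete_digraph_def intro: finite_subset)
  note v = \<open>v \<notin> ?V\<close>
  obtain T where T: "T \<subseteq> ?V" "card T = k" "\<And>t u. t \<in> T \<Longrightarrow> u \<in> ?V - T \<Longrightarrow> x u \<le> x t"
    and le: "\<And>f. ?mono f \<Longrightarrow>
      (\<Sum>(u, w)\<in>parcs G. f (x u) (x w)) \<le> (\<Sum>(u, w)\<in>star_arcs T ?V. f (x u) (x w))"
    using add_vertex.IH by blast
  have fT: "finite T" using T V by (auto intro: finite_subset)
  \<comment> \<open>The clique \<open>C\<close> has as many vertices as \<open>T\<close>, and
    \<open>T\<close> carries the largest values; by monotonicity the arcs from \<open>v\<close> to
    \<open>C\<close> weigh at most as much as arcs from \<open>v\<close> to \<open>T\<close>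
    would.\<close>
  have sumC: "(\<Sum>(u, w)\<in>parcs G \<union> {v} \<times> C \<union> C \<times> {v}. f (x u) (x w)) \<le>
      (\<Sum>(u, w)\<in>star_arcs T ?V. f (x u) (x w)) + (\<Sum>t\<in>T. f (x v) (x t) + f (x t) (x v))"
    if f: "?mono f" for f
  proof -
    have "(\<Sum>c\<in>C. f (x v) (x c) + f (x c) (x v)) \<le> (\<Sum>t\<in>T. f (x v) (x t) + f (x t) (x v))"
      using V(1) C T f x by (intro sum_le_sum_top[of ?V]) (auto intro!: add_mono)
    with le[OF f] show ?thesis
      by (simp add: sum_add_vertex[OF V(2) C(2) V(3) C(1) v])
  qed
  show ?case
  proof (cases "\<exists>t\<in>T. x t < x v")
    case False
    \<comment> \<open>No centre lies below \<open>v\<close>, so \<open>T\<close> stays on top and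
      \<open>v\<close> becomes a further leaf.\<close>
    have star: "star_arcs T (insert v ?V) = star_arcs T ?V \<union> {v} \<times> T \<union> T \<times> {v}"
      using v T(1) by (auto simp: star_arcs_def)
    have "(\<Sum>(u, w)\<in>parcs G \<union> {v} \<times> C \<union> C \<times> {v}. f (x u) (x w)) \<le>
        (\<Sum>(u, w)\<in>star_arcs T (insert v ?V). f (x u) (x w))" if "?mono f" for f
      unfolding star sum_add_vertex[OF finite_star_arcs[OF V(1)] fT star_arcs_subset T(1) v]
      using that by (rule sumC)
    moreover have "x u \<le> x t" if "t \<in> T" "u \<in> insert v ?V - T" for t u
      using that False T(3) by (auto simp: not_less)
    ultimately show ?thesis
      using T(1,2) by (intro exI[of _ T]) auto
  next
    case True
    define t where "t = arg_min_on x T"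
    have "T \<noteq> {}" using True by auto
    then have t: "t \<in> T" "\<And>s. s \<in> T \<Longrightarrow> x t \<le> x s"
      using arg_min_if_finite(1)[OF fT] arg_min_least[OF fT] by (auto simp: t_def)
    have tv: "x t < x v" using True t(2) by (meson le_less_trans)
    let ?T = "insert v (T - {t})"
    have vT: "v \<notin> T" using v T(1) by auto
    have star': "star_arcs ?T (insert v ?V) = star_arcs (T - {t}) ?V \<union> {v} \<times> ?V \<union> ?V \<times> {v}"
      using v by (auto simp: star_arcs_def)
    have star: "star_arcs T ?V = star_arcs (T - {t}) ?V \<union> ({t} \<times> (?V - T) \<union> (?V - T) \<times> {t})"
      using t T(1) by (auto simp: star_arcs_def)
    have disj: "star_arcs (T - {t}) ?V \<inter> ({t} \<times> (?V - T) \<union> (?V - T) \<times> {t}) = {}"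
        "({t} \<times> (?V - T)) \<inter> ((?V - T) \<times> {t}) = {}"
      using t(1) by (auto simp: star_arcs_def)
    have "(\<Sum>(u, w)\<in>parcs G \<union> {v} \<times> C \<union> C \<times> {v}. f (x u) (x w)) \<le>
        (\<Sum>(u, w)\<in>star_arcs ?T (insert v ?V). f (x u) (x w))" if f: "?mono f" for f
    proof -
      let ?S = "\<Sum>(u, w)\<in>star_arcs (T - {t}) ?V. f (x u) (x w)"
      have "(\<Sum>(u, w)\<in>star_arcs T ?V. f (x u) (x w)) =
          ?S + ((\<Sum>(u, w)\<in>{t} \<times> (?V - T). f (x u) (x w)) + (\<Sum>(u, w)\<in>(?V - T) \<times> {t}. f (x u) (x w)))"
        unfolding star
        by (subst sum.union_disjoint[OF _ _ disj(1)]; (subst sum.union_disjoint[OF _ _ disj(2)])?)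
          (use V(1) in \<open>auto simp: finite_star_arcs\<close>)
      also have "\<dots> = ?S + (\<Sum>u\<in>?V - T. f (x t) (x u) + f (x u) (x t))"
        by (simp add: sum.cartesian_product[symmetric] sum.distrib)
      \<comment> \<open>The arcs between \<open>t\<close> and the old leaves are moved to
        \<open>v\<close>, whose value is larger. Together with the arcs between \<open>v\<close> and
        \<open>T\<close> from \<open>sumC\<close> they join \<open>v\<close> to every vertex of
        \<open>?V\<close>, as the new star requires.\<close>
      also have "\<dots> \<le> ?S + (\<Sum>u\<in>?V - T. f (x v) (x u) + f (x u) (x v))"
        using f x tv by (intro add_left_mono sum_mono add_mono) auto
      finally have "(\<Sum>(u, w)\<in>parcs G \<union> {v} \<times> C \<union> C \<times> {v}. f (x u) (x w)) \<le> ?S +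
          ((\<Sum>u\<in>?V - T. f (x v) (x u) + f (x u) (x v)) + (\<Sum>u\<in>T. f (x v) (x u) + f (x u) (x v)))"
        using sumC[OF f] by simp
      also have "\<dots> = ?S + (\<Sum>u\<in>?V. f (x v) (x u) + f (x u) (x v))"
        by (simp only: sum.subset_diff[OF T(1) V(1)])
      also have "\<dots> = (\<Sum>(u, w)\<in>star_arcs ?T (insert v ?V). f (x u) (x w))"
        unfolding star'
        by (rule sum_add_vertex[OF finite_star_arcs[OF V(1)] V(1) star_arcs_subset order_refl v,
              symmetric])
      finally show ?thesis .
    qed
    moreover have "card ?T = k" using card_Suc_Diff1[OF fT t(1)] vT fT T(2) by simp
    \<comment> \<open>The only former centre among the new leaves is \<open>t\<close>; its
      minimality in \<open>T\<close> and \<open>x t < x v\<close> place it below every new centre.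
      The other leaves were already at most \<open>x t\<close>.\<close>
    moreover have "x u \<le> x s" if "s \<in> ?T" "u \<in> insert v ?V - ?T" for s u
    proof (cases "u = t")
      case True
      then show ?thesis using that t(2) tv by auto
    next
      case False
      then have "u \<in> ?V - T" using that by auto
      then show ?thesis using that T(3)[of s u] T(3)[OF t(1), of u] tv by auto
    qed
    ultimately show ?thesis
      using T(1) by (intro exI[of _ ?T]) auto
  qed
qed

section \<open>Isomorphism with the k-star as an equation between arc sets\<close>

text \<open>Tail and head are \<open>fst\<close> and \<open>snd\<close> in both graphs, so the
  vertex map determines the arc map of an isomorphism.\<close>

lemma digraph_iso_pair_iff:
  assumes "pair_wf_digraph G"
  shows "digraph_iso (with_proj G) (with_proj H) \<longleftrightarrow>
    (\<exists>f. inj_on f (pverts G) \<and> pverts H = f ` pverts G \<and> parcs H = map_prod f f ` parcs G)"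
    (is "?L \<longleftrightarrow> ?R")
proof
  interpret pair_wf_digraph G by fact
  {
    assume ?L
    then obtain h where h: "pre_digraph.digraph_isomorphism (with_proj G) h"
        "with_proj H = app_iso h (with_proj G)"
      by (auto simp: digraph_iso_def)
    let ?f = "iso_verts h"
    have tl: "iso_tail h = fst" "iso_head h = snd"
      using arg_cong[OF h(2), of tail] arg_cong[OF h(2), of head] by auto
    have "iso_arcs h e = map_prod ?f ?f e" if "e \<in> parcs G" for e
      using h(1) that by (auto simp: pre_digraph.digraph_isomorphism_def tl prod_eq_iff)
    then have "iso_arcs h ` parcs G = map_prod ?f ?f ` parcs G" by (rule image_cong[OF refl])
    moreover have "inj_on ?f (pverts G)"
      using h(1) by (simp add: pre_digraph.digraph_isomorphism_def)
    moreover have "pverts H = ?f ` pverts G" "parcs H = iso_arcs h ` parcs G"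
      using arg_cong[OF h(2), of verts] arg_cong[OF h(2), of arcs] by auto
    ultimately show ?R by auto
  }
  {
    assume ?R
    then obtain f where f: "inj_on f (pverts G)" "pverts H = f ` pverts G"
        "parcs H = map_prod f f ` parcs G"
      by auto
    let ?h = "\<lparr>iso_verts = f, iso_arcs = map_prod f f, iso_head = snd, iso_tail = fst\<rparr>"
    have "inj_on (map_prod f f) (parcs G)"
      using f(1) in_arcsD1 in_arcsD2
      by (intro inj_on_subset[OF map_prod_inj_on[OF f(1) f(1)]]) auto
    then have "pre_digraph.digraph_isomorphism (with_proj G) ?h"
      using f(1) wf_digraph_axioms by (auto simp: pre_digraph.digraph_isomorphism_def)
    moreover have "with_proj H = app_iso ?h (with_proj G)"
      using f by (simp add: app_iso_def with_proj_def)
    ultimately show ?L by (auto simp: digraph_iso_def)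
  }
qed

lemma digraph_iso_k_star_iff:
  assumes "pair_graph G" "card (pverts G) = n" "n \<ge> k"
  shows "digraph_iso (with_proj G) (with_proj (k_star k (n - k))) \<longleftrightarrow>
    (\<exists>T\<subseteq>pverts G. card T = k \<and> parcs G = star_arcs T (pverts G))" (is "?L \<longleftrightarrow> ?R")
proof
  interpret pair_graph G by fact
  let ?V = "Inl ` {1..k} :: (nat + nat) set" and ?U = "Inr ` {1..n - k} :: (nat + nat) set"
  have S: "pverts (k_star k (n - k)) = ?V \<union> ?U"
      "parcs (k_star k (n - k)) = star_arcs ?V (?V \<union> ?U)"
    by (auto simp: k_star_def Let_def star_arcs_def)
  note iff = digraph_iso_pair_iff[OF pair_wf_digraph_axioms, of "k_star k (n - k)", unfolded S]
  have E: "parcs G \<subseteq> pverts G \<times> pverts G"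
    using in_arcsD1 in_arcsD2 by auto
  {
    assume ?L
    then obtain f where f: "inj_on f (pverts G)" "?V \<union> ?U = f ` pverts G"
        "star_arcs ?V (?V \<union> ?U) = map_prod f f ` parcs G"
      using iff by auto
    \<comment> \<open>The centres of \<open>k_star\<close> are pulled back along the
      isomorphism.\<close>
    define T where "T = {v \<in> pverts G. f v \<in> ?V}"
    have "f ` T = f ` pverts G \<inter> ?V" by (auto simp: T_def)
    then have "f ` T = ?V" unfolding f(2)[symmetric] by auto
    moreover have "inj_on f T" using f(1) by (rule inj_on_subset) (auto simp: T_def)
    ultimately have "card T = card ?V" by (metis card_image)
    then have "card T = k" by (simp add: card_image)
    moreover have "parcs G = star_arcs T (pverts G)"
    proof -
      have "(u, w) \<in> parcs G \<longleftrightarrow> (f u, f w) \<in> star_arcs ?V (?V \<union> ?U)"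
        if "u \<in> pverts G" "w \<in> pverts G" for u w
        unfolding f(3)
        using inj_on_image_mem_iff[OF map_prod_inj_on[OF f(1) f(1)] _ E, of "(u, w)"] that by simp
      moreover have "(f u, f w) \<in> star_arcs ?V (?V \<union> ?U) \<longleftrightarrow> (u, w) \<in> star_arcs T (pverts G)"
        if "u \<in> pverts G" "w \<in> pverts G" for u w
        unfolding f(2) using that by (simp add: star_arcs_def T_def inj_on_eq_iff[OF f(1)])
      ultimately show ?thesis using E star_arcs_subset[of T "pverts G"] by auto
    qed
    ultimately show ?R by (intro exI[of _ T]) (auto simp: T_def)
  }
  {
    assume ?R
    then obtain T where T: "T \<subseteq> pverts G" "card T = k" "parcs G = star_arcs T (pverts G)"
      by auto
    have fT: "finite T" using T(1) by (rule finite_subset) simp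
    \<comment> \<open>Centres and leaves match in number separately; gluing the two bijections gives
      a vertex map that respects the role of each vertex, and these roles alone determine the arcs
      of a star.\<close>
    have "card ?V = card T" "card ?U = card (pverts G - T)"
      using T fT assms(2) by (simp_all add: card_image card_Diff_subset)
    then obtain g h where g: "bij_betw g T ?V" and h: "bij_betw h (pverts G - T) ?U"
      using fT by (metis bij_betw_iff_card finite_Diff finite_imageI finite_atLeastAtMost
          pair_finite_verts)
    define f where "f v = (if v \<in> T then g v else h v)" for v
    have fg: "bij_betw f T ?V" using g by (rule bij_betw_cong[THEN iffD1, rotated]) (simp add: f_def)
    have fh: "bij_betw f (pverts G - T) ?U"
      using h by (rule bij_betw_cong[THEN iffD1, rotated]) (simp add: f_def)
    have bij: "bij_betw f (pverts G) (?V \<union> ?U)"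
      using bij_betw_combine[OF fg fh] T(1) by (auto simp: Un_absorb1)
    have mem: "f v \<in> ?V \<longleftrightarrow> v \<in> T" if "v \<in> pverts G" for v
    proof (cases "v \<in> T")
      case False
      then have "f v \<in> ?U" using bij_betwE[OF fh] that by blast
      with False show ?thesis by auto
    qed (use bij_betwE[OF fg] in blast)
    have img: "f ` pverts G = ?V \<union> ?U" and inj: "inj_on f (pverts G)"
      using bij by (auto simp: bij_betw_def)
    have "star_arcs ?V (?V \<union> ?U) = map_prod f f ` parcs G"
    proof (intro equalityI subsetI)
      fix p assume p: "p \<in> star_arcs ?V (?V \<union> ?U)"
      then obtain u w where "u \<in> pverts G" "w \<in> pverts G" "p = (f u, f w)"
        unfolding img[symmetric] star_arcs_def by auto
      with p mem show "p \<in> map_prod f f ` parcs G"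
        unfolding T(3) by (intro image_eqI[of _ _ "(u, w)"]) (auto simp: star_arcs_def)
    next
      fix p assume "p \<in> map_prod f f ` parcs G"
      then obtain u w where uw: "p = (f u, f w)" "u \<in> pverts G" "w \<in> pverts G" "u \<noteq> w"
          "u \<in> T \<or> w \<in> T"
        unfolding T(3) star_arcs_def by auto
      then have "f u \<noteq> f w" "f u \<in> ?V \<or> f w \<in> ?V"
        using mem inj_on_eq_iff[OF inj] by blast+
      with uw show "p \<in> star_arcs ?V (?V \<union> ?U)"
        unfolding img[symmetric] star_arcs_def by blast
    qed
    with inj img show ?L using iff by metis
  }
qed

section \<open>The value of \<open>q1\<close> on stars and rigidity in the case of equality\<close>

text \<open>Serves both for \<open>k_star\<close> and for a \<open>G\<close> whose arcs form a star.
  The two values then agree by computation, without an appeal to invariance of \<open>q1\<close>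
  under isomorphism.\<close>

lemma q1_star:
  fixes a :: real
  assumes "pair_graph G" "T \<subseteq> pverts G" "card T = k" "parcs G = star_arcs T (pverts G)"
    and "k \<ge> 1" "card (pverts G) \<ge> k + 1"
    and "a > 0" "a * (a - (real (card (pverts G)) - 2)) = real k * (real (card (pverts G)) - real k)"
  shows "q1 (with_proj G) = a + k"
proof -
  interpret pair_graph G by fact
  have "signless_eigenfunction (pverts G) (parcs G) (a + k) (\<lambda>v. if v \<in> T then a else k)"
    unfolding assms(4) using assms by (intro star_eigenfunction) auto
  then show ?thesis
    using assms by (intro q1_eq_positive_eigenfunction) auto
qed

text \<open>
  If \<open>F\<close> has an arc outside the star, then the star has at least as many arcs outside \<open>F\<close>, each of
  strictly larger weight.
\<close>

lemma star_arcs_eqI: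
  fixes x :: "'a \<Rightarrow> real"
  assumes V: "finite V" and F: "F \<subseteq> V \<times> V" "irrefl F" "card F \<le> card (star_arcs T V)"
    and le: "(\<Sum>(u, w)\<in>star_arcs T V. (x u + x w)\<^sup>2) \<le> (\<Sum>(u, w)\<in>F. (x u + x w)\<^sup>2)"
    and xT: "\<And>v. v \<in> V \<inter> T \<Longrightarrow> x v = a" and xU: "\<And>v. v \<in> V - T \<Longrightarrow> x v = b"
    and b: "b > 0" "b \<le> a" and less: "F - star_arcs T V \<noteq> {} \<Longrightarrow> b < a"
  shows "F = star_arcs T V"
proof -
  let ?S = "star_arcs T V" and ?f = "\<lambda>(u, w). (x u + x w)\<^sup>2"
  have fin: "finite F" "finite ?S"
    using V F(1) by (auto intro: finite_subset finite_star_arcs)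
  have card: "card (F - ?S) \<le> card (?S - F)"
    using F(3) fin card_Diff_subset_Int[of F ?S] card_Diff_subset_Int[of ?S F]
    by (simp add: Int_commute)
  \<comment> \<open>An arc outside the star joins two distinct vertices, neither of them a
    centre.\<close>
  have "?f p = (2 * b)\<^sup>2" if p: "p \<in> F - ?S" for p
  proof -
    obtain u w where "p = (u, w)" "u \<in> V - T" "w \<in> V - T"
      using p F(1,2) by (auto simp: star_arcs_def irrefl_def)
    then show ?thesis by (simp add: xU)
  qed
  then have FS: "sum ?f (F - ?S) = card (F - ?S) * (2 * b)\<^sup>2" by simp
  have "?f p \<ge> (a + b)\<^sup>2" if p: "p \<in> ?S - F" for p
  proof -
    obtain u w where uw: "p = (u, w)" "u \<in> V" "w \<in> V" "u \<in> T \<or> w \<in> T"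
      using p by (auto simp: star_arcs_def)
    moreover have "x v \<ge> b" if "v \<in> V" for v
      using that xT[of v] xU[of v] b(2) by (cases "v \<in> T") auto
    ultimately have "x u + x w \<ge> a + b" using xT[of u] xT[of w] by fastforce
    then show ?thesis using uw b by (auto intro!: power_mono)
  qed
  then have SF: "sum ?f (?S - F) \<ge> card (?S - F) * (a + b)\<^sup>2"
    using sum_mono[of "?S - F" "\<lambda>_. (a + b)\<^sup>2" ?f] by simp
  have diff: "sum ?f (?S - F) \<le> sum ?f (F - ?S)"
    using le fin sum.Int_Diff[of F ?f ?S] sum.Int_Diff[of ?S ?f F] by (simp add: Int_commute)
  have sub: "F - ?S = {}"
  proof (rule ccontr)
    assume ne: "F - ?S \<noteq> {}"
    then have "(2 * b)\<^sup>2 < (a + b)\<^sup>2" using less b by (intro power_strict_mono) auto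
    moreover have "card (F - ?S) > 0" using ne fin by (simp add: card_gt_0_iff)
    ultimately have "card (F - ?S) * (2 * b)\<^sup>2 < card (F - ?S) * (a + b)\<^sup>2" by simp
    also have "\<dots> \<le> card (?S - F) * (a + b)\<^sup>2" using card by (intro mult_right_mono) auto
    finally show False using FS SF diff by linarith
  qed
  \<comment> \<open>With no arc of \<open>F\<close> outside the star, the inequality between the
    sums leaves no weight for star arcs outside \<open>F\<close>, each of which would contribute at
    least \<open>(a + b)\<^sup>2 > 0\<close>.\<close>
  then have "sum ?f (F - ?S) = 0" by (simp only: sum.empty)
  then have "card (?S - F) * (a + b)\<^sup>2 \<le> 0" using SF diff by linarith
  then have "card (?S - F) = 0" using b by (simp add: mult_le_0_iff not_le)
  with sub show ?thesis using fin by auto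
qed

section \<open>The extremal theorem for k-trees\<close>

theorem theorem2p2:
  fixes k n :: nat and G :: "'a pair_pre_digraph"
  assumes "k \<ge> 1" and "n \<ge> k + 1"
    and "k_tree k G" and "card (pverts G) = n"
  shows "q1 (with_proj G) \<le> q1 (with_proj (k_star k (n - k))) \<and>
    (q1 (with_proj G) = q1 (with_proj (k_star k (n - k))) \<longleftrightarrow>
      digraph_iso (with_proj G) (with_proj (k_star k (n - k))))"
proof -
  interpret pair_graph G using assms(3) by (rule k_tree_pair_graph)
  let ?V = "pverts G" and ?E = "parcs G"
  have E: "?E \<subseteq> ?V \<times> ?V" "sym ?E" "irrefl ?E"
    using in_arcsD1 in_arcsD2 pair_sym_arcs pair_no_loops[of "(v, v)" for v]
    by (auto simp: symmetric_def irrefl_def)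
  obtain a :: real where a: "a > 0" "a * (a - (real n - 2)) = real k * (real n - real k)"
      "n > k + 1 \<Longrightarrow> a > k"
    using star_positive_root[OF assms(1,2)] by blast
  let ?q = "a + k"
  note iso_iff = digraph_iso_k_star_iff[OF pair_graph_axioms assms(4), of k]
  have card_star: "card (pverts (k_star k (n - k))) = n"
  proof -
    have "card (Inl ` {1..k} \<union> Inr ` {1..n - k} :: (nat + nat) set) = k + (n - k)"
      by (subst card_Un_disjoint) (auto simp: card_image)
    then show ?thesis using assms(2) by (simp add: k_star_def Let_def)
  qed
  have qS: "q1 (with_proj (k_star k (n - k))) = ?q"
  proof (rule q1_star[OF pair_graph_k_star])
    show "parcs (k_star k (n - k)) = star_arcs (Inl ` {1..k}) (pverts (k_star k (n - k)))"
      by (auto simp: k_star_def Let_def star_arcs_def)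
  qed (use assms a card_star in \<open>auto simp: k_star_def Let_def card_image\<close>)
  have V: "?V \<noteq> {}" using assms by auto
  define \<mu> where "\<mu> = q1 (with_proj G)"
  obtain x where x: "\<exists>v\<in>?V. x v \<noteq> 0" "signless_eigenfunction ?V ?E \<mu> x"
    using eigenvalue_q1[OF pair_graph_axioms V]
    by (auto simp: eigenvalue_signless_laplacian_iff_eigenfunction[OF pair_fin_digraph_axioms] \<mu>_def)
  \<comment> \<open>Nonnegative values make the weight \<open>(y u + y w)\<^sup>2\<close> monotone.
    By the triangle inequality the form does not decrease, while the squared norm \<open>N\<close>
    is the same for \<open>x\<close> and \<open>y\<close>.\<close>
  define y where "y v = \<bar>x v\<bar>" for v
  define N where "N = (\<Sum>v\<in>?V. (y v)\<^sup>2)"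
  have N: "N > 0"
    using x(1) unfolding N_def y_def by (auto intro!: sum_pos2)
  obtain T where T: "T \<subseteq> ?V" "card T = k"
    and dom: "\<And>f. (\<forall>a a' b b'. 0 \<le> a \<longrightarrow> a \<le> a' \<longrightarrow> 0 \<le> b \<longrightarrow> b \<le> b' \<longrightarrow> f a b \<le> f a' b') \<Longrightarrow>
      (\<Sum>(u, w)\<in>?E. f (y u) (y w)) \<le> (\<Sum>(u, w)\<in>star_arcs T ?V. f (y u) (y w) :: real)"
    using k_tree_arc_sum_le_star[OF assms(3), of y] by (auto simp: y_def)
  let ?S = "star_arcs T ?V"
  define z where "z = (\<lambda>v. if v \<in> T then a else real k)"
  have z: "signless_eigenfunction ?V ?S ?q z" and zpos: "z v > 0" for v
    using assms a T star_eigenfunction[of ?V T k a] by (auto simp: z_def)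
  from zpos have "\<forall>v\<in>?V. z v > 0" by simp
  note S = pair_finite_verts star_arcs_subset sym_star_arcs z this
  have "2 * \<mu> * N = (\<Sum>(u, w)\<in>?E. (x u + x w)\<^sup>2)"
    using quadratic_form_eigenfunction[OF pair_finite_verts E(1,2) x(2)] by (simp add: N_def y_def)
  also have "\<dots> \<le> (\<Sum>(u, w)\<in>?E. (y u + y w)\<^sup>2)"
    by (intro sum_mono) (auto simp: y_def intro!: abs_le_square_iff[THEN iffD1])
  finally have 1: "2 * \<mu> * N \<le> (\<Sum>(u, w)\<in>?E. (y u + y w)\<^sup>2)" .
  have 2: "(\<Sum>(u, w)\<in>?E. (y u + y w)\<^sup>2) \<le> (\<Sum>(u, w)\<in>?S. (y u + y w)\<^sup>2)"
    by (rule dom) (auto intro!: power_mono)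
  have 3: "(\<Sum>(u, w)\<in>?S. (y u + y w)\<^sup>2) \<le> 2 * ?q * N"
    unfolding N_def by (rule quadratic_form_le_positive_eigenfunction[OF S])
  have le: "\<mu> \<le> ?q"
    using order_trans[OF 1 order_trans[OF 2 3]] N by simp
  have "digraph_iso (with_proj G) (with_proj (k_star k (n - k)))" if "\<mu> = ?q"
  proof -
    \<comment> \<open>For \<open>\<mu> = ?q\<close> the chain of the three estimates begins and ends
      with the same number, so all of them are equalities.\<close>
    have eq: "(\<Sum>(u, w)\<in>?S. (y u + y w)\<^sup>2) = 2 * ?q * N"
      and ge: "(\<Sum>(u, w)\<in>?S. (y u + y w)\<^sup>2) \<le> (\<Sum>(u, w)\<in>?E. (y u + y w)\<^sup>2)"
      using 1 2 3 that by auto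
    \<comment> \<open>A centre is adjacent to every other vertex of the star, so the equal ratios
      along its arcs already give one constant \<open>c\<close> for all vertices.\<close>
    obtain t where t: "t \<in> T" using T(2) assms(1) by fastforce
    define c where "c = y t / z t"
    have yz: "y v = c * z v" if "v \<in> ?V" for v
    proof (cases "v = t")
      case False
      then have "(t, v) \<in> ?S" using t T(1) that by (auto simp: star_arcs_def)
      then have "y t / z t = y v / z v"
        using quadratic_form_eq_positive_eigenfunction[OF S] eq by (simp add: N_def)
      then show ?thesis using zpos[of v] by (simp add: c_def)
    qed (use zpos[of t] in \<open>simp add: c_def\<close>)
    obtain v where "v \<in> ?V" "x v \<noteq> 0" using x(1) by auto
    then have "c * z v > 0" using yz by (metis y_def zero_less_abs_iff)
    then have c: "c > 0" using zpos[of v] by (simp add: zero_less_mult_iff)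
    \<comment> \<open>The case \<open>n = k + 1\<close> remains, where the quadratic reads
      \<open>a * (a - (k - 1)) = k\<close>. If \<open>a < k\<close>, the second factor is below 1,
      and the product is less than \<open>a\<close>, hence less than \<open>k\<close>.\<close>
    have "a \<ge> k"
    proof (cases "n > k + 1")
      case False
      then have n: "real n = k + 1" using assms(2) by simp
      show ?thesis
      proof (rule ccontr)
        assume "\<not> a \<ge> k"
        then have "a * (a - (real k - 1)) < a * 1" using a(1)
          by (intro mult_strict_left_mono) auto
        moreover have "a * (a - (real k - 1)) = k" using a(2) n by simp
        ultimately show False using \<open>\<not> a \<ge> k\<close> by simp
      qed
    qed (use a(3) in simp)
    have "?E = ?S"
    proof (rule star_arcs_eqI[OF pair_finite_verts E(1,3) _ ge])
      show "card ?E \<le> card ?S" using dom[of "\<lambda>_ _. 1"] by simp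
      show "y v = c * a" if "v \<in> ?V \<inter> T" for v using that yz by (simp add: z_def)
      show "y v = c * k" if "v \<in> ?V - T" for v using that yz by (simp add: z_def)
      show "c * k > 0" using c assms(1) by simp
      show "c * k \<le> c * a" using c \<open>a \<ge> k\<close> by simp
      \<comment> \<open>An arc of \<open>G\<close> outside the star needs two distinct leaves, so
        \<open>n > k + 1\<close>; this is exactly when the strict bound \<open>a > k\<close> is
        available.\<close>
      assume "?E - ?S \<noteq> {}"
      then obtain u w where uw: "u \<in> ?V - T" "w \<in> ?V - T" "u \<noteq> w"
        using E by (auto simp: star_arcs_def irrefl_def)
      then have "card {u, w} \<le> card (?V - T)" by (intro card_mono) auto
      then have "n > k + 1"
        using uw T assms(4) finite_subset[OF T(1)] by (simp add: card_Diff_subset)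
      then show "c * k < c * a" using a(3) c by simp
    qed
    then show ?thesis using iso_iff T assms(2) by auto
  qed
  moreover have "\<mu> = ?q" if iso: "digraph_iso (with_proj G) (with_proj (k_star k (n - k)))"
  proof -
    obtain T where "T \<subseteq> ?V" "card T = k" "?E = star_arcs T ?V"
      using iso iso_iff assms(2) by auto
    then show ?thesis unfolding \<mu>_def
      using assms a by (intro q1_star[OF pair_graph_axioms]) auto
  qed
  ultimately show ?thesis using le unfolding qS \<mu>_def by auto
qed

end
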